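(* Let $\mathbb{F}$ be an algebraically closed field and let $q\in\mathbb{F}$ be nonzero with $q^4\neq 1$. In the free unital associative algebra $\mathbb{F}\langle A,B,C\rangle$, let $$\alpha=(q+q^{-1})A+\frac{qBC-q^{-1}CB}{q-q^{-1}},\quad \beta=(q+q^{-1})B+\frac{qCA-q^{-1}AC}{q-q^{-1}},\quad \gamma=(q+q^{-1})C+\frac{qAB-q^{-1}BA}{q-q^{-1}}.$$ Let $\mathcal{L}$ be the Lie subalgebra of $\mathbb{F}\langle A,B,C\rangle$ generated by $A,B,C$. Then none of the nine elements $[X,\delta]$ with $X\in\{A,B,C\}$ and $\delta\in\{\alpha,\beta,\gamma\}$ belongs to $\mathcal{L}$.
   Context: $[X,Y]=XY-YX$. The nine elements $[X,\delta]$ are the defining relators of the universal Askey-Wilson algebra; $\mathcal{L}$ is the free Lie algebra on $\{A,B,C\}$. *)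

theory Defs
  imports "HOL-Library.Poly_Mapping" "HOL-Computational_Algebra.Polynomial"
begin

text \<open>
  The free algebra on a set of letters is the monoid algebra of the free monoid, i.e. the
  finitely supported functions on words with the convolution product of
  \<^theory>\<open>HOL-Library.Poly_Mapping\<close>. That product multiplies basis elements by adding their
  exponents in a (not necessarily commutative) additive monoid, so concatenation of words has to
  be written as \<open>+\<close>.
\<close>

datatype 'x free_monoid = Word (letters: "'x list")

instantiation free_monoid :: (type) monoid_add
begin

definition zero_free_monoid :: "'a free_monoid" where
  "0 = Word []"

definition plus_free_monoid :: "'a free_monoid \<Rightarrow> 'a free_monoid \<Rightarrow> 'a free_monoid" where
  "u + v = Word (letters u @ letters v)"

instance
  by standard (simp_all add: zero_free_monoid_def plus_free_monoid_def)

end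

type_synonym ('x, 'k) free_algebra = "'x free_monoid \<Rightarrow>\<^sub>0 'k"

definition letter :: "'x \<Rightarrow> ('x, 'k::field) free_algebra" where
  "letter x = Poly_Mapping.single (Word [x]) 1"

definition scalar_mult :: "'k::field \<Rightarrow> ('x, 'k) free_algebra \<Rightarrow> ('x, 'k) free_algebra"
    (infixr \<open>\<odot>\<close> 75) where
  "c \<odot> f = Poly_Mapping.single 0 c * f"

global_interpretation free_algebra: vector_space scalar_mult
  by standard
    (simp_all add: scalar_mult_def distrib_left distrib_right single_add mult_single
      flip: mult.assoc)

definition commutator :: "'r::ring \<Rightarrow> 'r \<Rightarrow> 'r" where
  "commutator x y = x * y - y * x"

definition lie_subalgebra :: "('x, 'k::field) free_algebra set \<Rightarrow> bool" where
  "lie_subalgebra S \<longleftrightarrow>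
     free_algebra.subspace S \<and> (\<forall>x\<in>S. \<forall>y\<in>S. commutator x y \<in> S)"

definition lie_generated :: "('x, 'k::field) free_algebra set \<Rightarrow> ('x, 'k) free_algebra set" where
  "lie_generated G = lie_subalgebra hull G"

lemma lie_subalgebra_lie_generated: "lie_subalgebra (lie_generated G)"
  unfolding lie_generated_def
  by (rule hull_in) (auto simp: lie_subalgebra_def free_algebra.subspace_def)

datatype abc = LetterA | LetterB | LetterC

abbreviation genA :: "(abc, 'k::field) free_algebra" where "genA \<equiv> letter LetterA"
abbreviation genB :: "(abc, 'k::field) free_algebra" where "genB \<equiv> letter LetterB"
abbreviation genC :: "(abc, 'k::field) free_algebra" where "genC \<equiv> letter LetterC"

definition aw_alpha :: "'k::field \<Rightarrow> (abc, 'k) free_algebra" where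
  "aw_alpha q = (q + inverse q) \<odot> genA
     + inverse (q - inverse q) \<odot> (q \<odot> (genB * genC) - inverse q \<odot> (genC * genB))"

definition aw_beta :: "'k::field \<Rightarrow> (abc, 'k) free_algebra" where
  "aw_beta q = (q + inverse q) \<odot> genB
     + inverse (q - inverse q) \<odot> (q \<odot> (genC * genA) - inverse q \<odot> (genA * genC))"

definition aw_gamma :: "'k::field \<Rightarrow> (abc, 'k) free_algebra" where
  "aw_gamma q = (q + inverse q) \<odot> genC
     + inverse (q - inverse q) \<odot> (q \<odot> (genA * genB) - inverse q \<odot> (genB * genA))"

end

theory Submission
  imports Defs
begin

text \<open>
  The anti-automorphism that reverses words and multiplies a word of length \<open>n\<close> by \<open>(-1)\<^sup>n\<close>
  (the antipode of the free algebra) maps every letter to its negative, hence acts as \<open>-1\<close> on the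
  Lie subalgebra generated by the letters. So a Lie element has equal coefficients at a word of
  length three and at its reversal. For \<open>\<delta> = a u + b (q y z - q\<^sup>-\<^sup>1 z y)\<close> with \<open>y \<noteq> z\<close> the
  coefficients of \<open>[x, \<delta>]\<close> at \<open>x y z\<close> and \<open>z y x\<close> (or at \<open>x z y\<close> and \<open>y z x\<close>, if \<open>x = z\<close>) are
  \<open>b\<close> times different elements of \<open>{q, q\<^sup>-\<^sup>1}\<close>, up to a common sign.
\<close>

abbreviation word_coeff :: "('x, 'k::field) free_algebra \<Rightarrow> 'x list \<Rightarrow> 'k" where
  "word_coeff f w \<equiv> Poly_Mapping.lookup f (Word w)"

text \<open>Reduces additive identities to basis elements: updating a fresh key amounts to adding a
  \<open>single\<close>.\<close>

lemma poly_mapping_single_induct [case_names zero single add]: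
  fixes f :: "'a \<Rightarrow>\<^sub>0 'b::comm_monoid_add"
  assumes "P 0" and "\<And>a b. P (Poly_Mapping.single a b)"
    and "\<And>f g. P f \<Longrightarrow> P g \<Longrightarrow> P (f + g)"
  shows "P f"
proof (induction f rule: update_induct)
  case (update f a b)
  then have "Poly_Mapping.update a b f = f + Poly_Mapping.single a b"
    by (intro poly_mapping_eqI)
      (auto simp: lookup_update lookup_add lookup_single when_def in_keys_iff)
  with update assms show ?case
    by simp
qed (fact assms(1))

lemma lookup_times_Word:
  fixes f g :: "('x, 'k::field) free_algebra"
  shows "word_coeff (f * g) w =
    (\<Sum>i\<le>length w. word_coeff f (take i w) * word_coeff g (drop i w))"
proof (induction f rule: poly_mapping_single_induct)
  case (single u c)
  show ?case
  proof (induction g rule: poly_mapping_single_induct)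
    case (single v d)
    \<comment> \<open>The length of the prefix determines the cut, so at most one summand
      survives.\<close>
    have split: "u = Word (take i w) \<and> v = Word (drop i w) \<longleftrightarrow>
        i = length (letters u) \<and> u + v = Word w" if "i \<le> length w" for i
      using that by (cases u; cases v) (auto simp: plus_free_monoid_def)
    have "(\<Sum>i\<le>length w. word_coeff (Poly_Mapping.single u c) (take i w) *
        word_coeff (Poly_Mapping.single v d) (drop i w)) =
      (\<Sum>i\<le>length w. c * d when u = Word (take i w) \<and> v = Word (drop i w))"
      by (intro sum.cong refl) (auto simp: lookup_single when_def)
    also have "\<dots> = (\<Sum>i\<le>length w.
        if i = length (letters u) then c * d when u + v = Word w else 0)"
      by (intro sum.cong refl) (simp add: split when_def)
    also have "\<dots> = (c * d when u + v = Word w)"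
      by (auto simp: when_def plus_free_monoid_def)
    finally show ?case
      by (simp add: mult_single lookup_single)
  qed (simp_all add: distrib_left lookup_add sum.distrib)
qed (simp_all add: distrib_right lookup_add sum.distrib)

lemma lookup_scalar_mult [simp]:
  "Poly_Mapping.lookup (c \<odot> f) w = c * Poly_Mapping.lookup f w"
proof (cases w)
  case (Word v)
  have "word_coeff (c \<odot> f) v = (\<Sum>i\<in>{0}. c * word_coeff f (drop i v))"
    unfolding scalar_mult_def lookup_times_Word
    by (rule sum.mono_neutral_cong_right)
      (auto simp: lookup_single when_def zero_free_monoid_def)
  then show ?thesis
    by (simp add: Word)
qed

text \<open>The eigenspace of the antipode for -1, expressed through coefficients so that the map
  itself need not be constructed.\<close>

definition antipode_odd :: "('x, 'k::field) free_algebra \<Rightarrow> bool" where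
  "antipode_odd f \<longleftrightarrow>
    (\<forall>w. word_coeff f (rev w) = - ((-1) ^ length w * word_coeff f w))"

lemma antipode_odd_letter: "antipode_odd (letter x)"
  by (auto simp: antipode_odd_def letter_def lookup_single when_def)

text \<open>The antipode reverses products, and the two signs from \<open>f\<close> and
  \<open>g\<close> cancel, so it sends \<open>g * f\<close> to \<open>f * g\<close>.\<close>

lemma lookup_times_rev:
  assumes "antipode_odd f" and "antipode_odd g"
  shows "word_coeff (f * g) (rev w) = (-1) ^ length w * word_coeff (g * f) w"
proof -
  have "word_coeff (f * g) (rev w) =
      (\<Sum>i\<le>length w. word_coeff f (rev (drop (length w - i) w)) *
        word_coeff g (rev (take (length w - i) w)))"
    by (simp add: lookup_times_Word take_rev drop_rev)
  \<comment> \<open>Cuts are now counted from the other end of the word.\<close>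
  also have "\<dots> = (\<Sum>i\<le>length w. word_coeff f (rev (drop i w)) *
        word_coeff g (rev (take i w)))"
    by (rule sum.reindex_bij_witness[of _ "\<lambda>i. length w - i" "\<lambda>i. length w - i"]) auto
  also have "\<dots> = (\<Sum>i\<le>length w. (-1) ^ length w *
        (word_coeff g (take i w) * word_coeff f (drop i w)))"
  proof (intro sum.cong refl)
    fix i assume "i \<in> {..length w}"
    then have "(-1 :: 'b) ^ length w = (-1) ^ length (drop i w) * (-1) ^ length (take i w)"
      by (simp flip: power_add)
    then show "word_coeff f (rev (drop i w)) * word_coeff g (rev (take i w)) =
        (-1) ^ length w * (word_coeff g (take i w) * word_coeff f (drop i w))"
      using assms by (simp add: antipode_odd_def ac_simps del: length_take length_drop)
  qed
  finally show ?thesis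
    by (simp add: lookup_times_Word sum_distrib_left)
qed

lemma lie_subalgebra_antipode_odd: "lie_subalgebra (Collect antipode_odd)"
  unfolding lie_subalgebra_def free_algebra.subspace_def
proof (intro conjI ballI allI)
  fix f g :: "('a, 'b) free_algebra"
  assume "f \<in> Collect antipode_odd" and "g \<in> Collect antipode_odd"
  then show "commutator f g \<in> Collect antipode_odd"
    unfolding antipode_odd_def[of "commutator f g"] mem_Collect_eq
    by (simp add: commutator_def lookup_minus lookup_times_rev algebra_simps)
qed (auto simp: antipode_odd_def lookup_add algebra_simps)

lemma lookup_rev_lie_generated:
  assumes "f \<in> lie_generated (range letter)"
  shows "word_coeff f (rev w) = - ((-1) ^ length w * word_coeff f w)"
proof -
  have "lie_generated (range letter) \<subseteq> Collect antipode_odd"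
    unfolding lie_generated_def
    using lie_subalgebra_antipode_odd by (intro hull_minimal) (auto intro: antipode_odd_letter)
  then show ?thesis
    using assms by (auto simp: antipode_odd_def)
qed

text \<open>The linear term \<open>a \<odot> letter u\<close> contributes only words of length two,
  so it is invisible at length three.\<close>

lemma commutator_quadratic_notin_lie_generated:
  fixes q :: "'k::field"
  assumes "y \<noteq> z" and "b \<noteq> 0" and "q \<noteq> r"
  shows "commutator (letter x)
      (a \<odot> letter u + b \<odot> (q \<odot> (letter y * letter z) - r \<odot> (letter z * letter y)))
    \<notin> lie_generated (range letter)" (is "?f \<notin> _")
proof
  assume *: "?f \<in> lie_generated (range letter)"
  have coeff_letter: "word_coeff (letter s) w = (1 when w = [s])"
    for s w by (auto simp: letter_def lookup_single when_def)
  \<comment> \<open>For \<open>x = z\<close> the word \<open>[x, y, z]\<close> is a palindrome and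
    gives no information, hence the swap. In both cases \<open>w\<close> starts with
    \<open>x\<close> and ends in another letter, so only one of the two products contributes at
    \<open>w\<close> and only the other at \<open>rev w\<close>.\<close>
  define w where "w = (if x = z then [x, z, y] else [x, y, z])"
  have "word_coeff ?f (rev w) = word_coeff ?f w"
    using lookup_rev_lie_generated[OF *, of w] by (auto simp: w_def)
  then show False
    using assms unfolding w_def commutator_def
    by (auto simp: lookup_minus lookup_add lookup_times_Word coeff_letter when_def
        atMost_Suc numeral_3_eq_3 split: if_splits)
qed

lemma UNIV_abc: "UNIV = {LetterA, LetterB, LetterC}"
  by (auto intro: abc.exhaust)

theorem proposition3p2:
  fixes q :: "'k::alg_closed_field"
  assumes "q \<noteq> 0" and "q ^ 4 \<noteq> 1"
  shows "\<forall>X \<in> {genA, genB, genC}. \<forall>\<delta> \<in> {aw_alpha q, aw_beta q, aw_gamma q}.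
           commutator X \<delta> \<notin> lie_generated {genA, genB, genC}"
proof -
  \<comment> \<open>Used twice: the denominator is nonzero, and the two quadratic coefficients
    differ.\<close>
  have ne: "q \<noteq> inverse q"
  proof
    assume "q = inverse q"
    then have "q ^ 2 = 1"
      using assms(1) by (metis power2_eq_square right_inverse)
    then have "(q ^ 2) ^ 2 = 1"
      by simp
    with assms(2) show False
      by (simp flip: power_mult)
  qed
  then have nz: "inverse (q - inverse q) \<noteq> 0"
    by simp
  have gens: "{genA, genB, genC} = range (letter :: abc \<Rightarrow> (abc, 'k) free_algebra)"
    by (auto simp: UNIV_abc)
  show ?thesis
    unfolding gens aw_alpha_def aw_beta_def aw_gamma_def
    by (intro ballI; elim insertE emptyE rangeE)
      (simp_all only:, (rule commutator_quadratic_notin_lie_generated[OF _ nz ne], simp)+)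
qed

end
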